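(* Let $\mathcal{J}$ be a p.l.i. $\sigma$-ideal in $\mathbb{R}$, and let $M$ be a member of the family $\Omega(\mathcal{J})$. Assume that functions $a,b,c,d:(0,\infty)\to\mathbb{R}$ satisfy $$a(x)+b(y)=c(x+y)+d\left(\frac{x}{y}\right)\qquad\text{for all }(x,y)\in(0,\infty)^2\setminus M,$$ and that $T(M)\in\Omega(\mathcal{J})$ for every unimodular transformation $T$ of the real plane $\mathbb{R}^2$. Then there exist an additive function $A:(0,\infty)\to\mathbb{R}$, logarithmic type functions $L_a,L_b:(0,\infty)\to\mathbb{R}$ and real constants $\alpha,\beta,\gamma$ such that $$a(x)=A(x)+L_a(x)+\alpha,\qquad b(x)=A(x)+L_b(x)+\beta,\qquad c(x)=A(x)+L_a(x)+L_b(x)+\gamma$$ and $$d(x)=L_a\left(\frac{x}{x+1}\right)-L_b(x+1)+\alpha+\beta-\gamma$$ for $\mathcal{J}$-almost all $x\in(0,\infty)$.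
   Context: A proper linearly invariant $\sigma$-ideal (p.l.i. $\sigma$-ideal) in $\mathbb{R}$ is a nonempty family $\mathcal{J}\subset 2^{\mathbb{R}}\setminus\{\mathbb{R}\}$ such that: (i) if $A_n\in\mathcal{J}$ for all $n\in\mathbb{N}$, then $\bigcup_{n\in\mathbb{N}}A_n\in\mathcal{J}$; (ii) if $A\in\mathcal{J}$ and $B\subset A$, then $B\in\mathcal{J}$; (iii) if $A\in\mathcal{J}$, $\alpha\in\mathbb{R}\setminus\{0\}$ and $\beta\in\mathbb{R}$, then $\alpha A+\beta\in\mathcal{J}$. A property holds for $\mathcal{J}$-almost all $x$ in a set $D\subset\mathbb{R}$ if there is $U\in\mathcal{J}$ such that it holds for all $x\in D\setminus U$. For $M\subset\mathbb{R}^2$ and $x\in\mathbb{R}$ the section is $M[x]:=\{y\in\mathbb{R}:(x,y)\in M\}$, and $$\Omega(\mathcal{J}):=\{M\subset\mathbb{R}^2:\ M[x]\in\mathcal{J}\text{ for }\mathcal{J}\text{-almost all }x\in\mathbb{R}\}.$$ A unimodular transformation of the real plane is a linear map $T:\mathbb{R}^2\to\mathbb{R}^2$ with $|\det T|=1$. A function $A:(0,\infty)\to\mathbb{R}$ is called additive if $A(x+y)=A(x)+A(y)$ for all $x,y>0$. A function $L:(0,\infty)\to\mathbb{R}$ is called a logarithmic type function if $L(xy)=L(x)+L(y)$ for all $x,y>0$. *)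

theory Defs
  imports "HOL-Analysis.Analysis"
begin

definition pli_sigma_ideal :: "real set set \<Rightarrow> bool" where
  "pli_sigma_ideal J \<longleftrightarrow>
     J \<noteq> {} \<and> UNIV \<notin> J \<and>
     (\<forall>A :: nat \<Rightarrow> real set. (\<forall>n. A n \<in> J) \<longrightarrow> (\<Union>n. A n) \<in> J) \<and>
     (\<forall>A B. A \<in> J \<and> B \<subseteq> A \<longrightarrow> B \<in> J) \<and>
     (\<forall>A \<alpha> \<beta>. A \<in> J \<and> \<alpha> \<noteq> 0 \<longrightarrow> (\<lambda>x. \<alpha> * x + \<beta>) ` A \<in> J)"

definition almost_all_in :: "real set set \<Rightarrow> real set \<Rightarrow> (real \<Rightarrow> bool) \<Rightarrow> bool" where
  "almost_all_in J D P \<longleftrightarrow> (\<exists>U \<in> J. \<forall>x \<in> D - U. P x)"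

(* The plane is real^2, and the point (x, y) is the vector [x, y]. *)
definition plane_section :: "(real^2) set \<Rightarrow> real \<Rightarrow> real set" where
  "plane_section M x = {y. vector [x, y] \<in> M}"

definition Omega :: "real set set \<Rightarrow> (real^2) set set" where
  "Omega J = {M. almost_all_in J UNIV (\<lambda>x. plane_section M x \<in> J)}"

definition unimodular :: "(real^2 \<Rightarrow> real^2) \<Rightarrow> bool" where
  "unimodular T \<longleftrightarrow> linear T \<and> \<bar>det (matrix T)\<bar> = 1"

(* A function on the open half-line (0, \<infinity>) is represented by a total function on the reals;
   its values at arguments x \<le> 0 are unconstrained and never used. *)
definition additive_on_pos :: "(real \<Rightarrow> real) \<Rightarrow> bool" where
  "additive_on_pos A \<longleftrightarrow> (\<forall>x > 0. \<forall>y > 0. A (x + y) = A x + A y)"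

definition logarithmic_type :: "(real \<Rightarrow> real) \<Rightarrow> bool" where
  "logarithmic_type L \<longleftrightarrow> (\<forall>x > 0. \<forall>y > 0. L (x * y) = L x + L y)"

end

theory Submission
  imports Defs
begin

text \<open>
  The proof has three ideas.

  First, the ideal \<open>J\<close> acts through the quantifier ``for almost all'', which is the filter
  of complements of members of \<open>J\<close>. This filter is affinely invariant and each of its members
  meets every nonempty open interval (\<open>affine_filter_co_ideal\<close>). The hypothesis on the
  images of \<open>M\<close> replaces Fubini's theorem: the given equation holds at almost all points of almost
  all vertical lines, horizontal lines and lines \<open>x + y = s\<close> (\<open>generic_pair_compl\<close>).

  Secondly, \<open>x / y\<close> is unchanged when \<open>(x, y)\<close> is multiplied by \<open>z > 0\<close>. The increments
  \<open>a (z * x) - a x\<close>, \<open>b (z * x) - b x\<close> and \<open>c (z * x) - c x\<close> therefore satisfy a Pexider equation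
  almost everywhere, so by \<open>pexider_generic\<close> they are \<open>H z x + p z\<close>, \<open>H z x + q z\<close> and
  \<open>H z x + p z + q z\<close> with \<open>H z\<close> additive. Applying two factors in succession shows that
  \<open>p\<close> and \<open>q\<close> are logarithmic and that \<open>H z x = A (z * x) - A x\<close> with \<open>A = H 2\<close>
  (\<open>scaling_cocycle\<close>). This produces the additive and the two logarithmic functions.

  Thirdly, what remains of \<open>a\<close>, \<open>b\<close>, \<open>c\<close> after subtracting these parts is invariant under each
  factor \<open>z\<close>, up to an exceptional set that depends on \<open>z\<close>, and still solves the equation together
  with a modified \<open>d\<close>. Substituting \<open>x * y\<close> for \<open>y\<close> on a fixed vertical line removes \<open>x\<close> from
  all terms except \<open>a x\<close>, so that \<open>a\<close> is constant almost everywhere; the other functions follow by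
  variants of this substitution (\<open>scale_invariant_constant\<close>).
\<close>

section \<open>Almost all points of the line and of the plane\<close>

text \<open>
  Read \<open>\<forall>\<^sub>F x in F. P x\<close> as ``for almost all real \<open>x\<close>''. The functional equations below need two
  properties of this quantifier: almost all points remain almost all points after an affine
  substitution, and every nonempty open interval contains a good point.
\<close>

locale affine_filter =
  fixes F :: "real filter"
  assumes affine: "eventually P F \<Longrightarrow> k \<noteq> 0 \<Longrightarrow> \<forall>\<^sub>F x in F. P (k * x + m)"
    and meets: "eventually P F \<Longrightarrow> l < u \<Longrightarrow> \<exists>x. l < x \<and> x < u \<and> P x"
begin

lemma meets_above:
  assumes "eventually P F"
  obtains x where "l < x" "P x"
  using meets[OF assms, of l "l + 1"] by auto

text \<open>
  The property holds at almost every point of almost every line in each of three families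
  of parallel lines: the vertical lines, the horizontal lines and the lines \<open>x + y = s\<close>.
  For an abstract ideal there is no theorem of Fubini type that would deduce one of the three
  conditions from another, so they are carried along together. Lines through the origin, on which
  \<open>x / y\<close> is constant, form no parallel family and nothing is known about them individually.
\<close>

definition generic_pair :: "(real \<Rightarrow> real \<Rightarrow> bool) \<Rightarrow> bool" where
  "generic_pair Q \<longleftrightarrow> (\<forall>\<^sub>F x in F. \<forall>\<^sub>F y in F. Q x y) \<and> (\<forall>\<^sub>F y in F. \<forall>\<^sub>F x in F. Q x y)
     \<and> (\<forall>\<^sub>F s in F. \<forall>\<^sub>F t in F. Q t (s - t))"

lemma eventually2_mono:
  assumes "\<forall>\<^sub>F x in F. \<forall>\<^sub>F y in F. Q x y" "\<And>x y. Q x y \<Longrightarrow> R x y"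
  shows "\<forall>\<^sub>F x in F. \<forall>\<^sub>F y in F. R x y"
  using assms by (blast intro: eventually_mono)

lemma generic_pair_mono:
  assumes "generic_pair Q" "\<And>x y. Q x y \<Longrightarrow> R x y"
  shows "generic_pair R"
  using assms(1) unfolding generic_pair_def
  by (elim conjE, intro conjI) (erule eventually2_mono, erule assms(2))+

lemma generic_pair_conj:
  assumes "generic_pair Q" "generic_pair R"
  shows "generic_pair (\<lambda>x y. Q x y \<and> R x y)"
  using assms unfolding generic_pair_def by (simp add: eventually_conj_iff)

text \<open>
  A homothety centred at the origin permutes the lines of each family and is affine on every line.
\<close>

lemma generic_pair_scale:
  assumes "generic_pair Q" "k > 0"
  shows "generic_pair (\<lambda>x y. Q (k * x) (k * y))"
proof -
  have scale: "\<forall>\<^sub>F x in F. \<forall>\<^sub>F y in F. R (k * x) (k * y)"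
    if "\<forall>\<^sub>F x in F. \<forall>\<^sub>F y in F. R x y" for R
  proof -
    have "\<forall>\<^sub>F x in F. \<forall>\<^sub>F y in F. R (k * x) y"
      using affine[OF that, of k 0] \<open>k > 0\<close> by simp
    then show ?thesis
      by eventually_elim (use affine[of _ k 0] \<open>k > 0\<close> in auto)
  qed
  show ?thesis
    using scale[of Q] scale[of "\<lambda>y x. Q x y"] scale[of "\<lambda>s t. Q t (s - t)"] assms(1)
    unfolding generic_pair_def by (simp add: right_diff_distrib)
qed

section \<open>The Pexider equation almost everywhere\<close>

text \<open>
  If \<open>D = A - B\<close> is constant almost everywhere on the half-line, then
  \<open>D x = D (s + x) - D s\<close> vanishes, because \<open>s\<close> can be chosen so large and so generic that
  both \<open>s\<close> and \<open>s + x\<close> are good points. So two almost everywhere representations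
  by ``additive function plus constant'' coincide everywhere.
\<close>

lemma additive_eqI:
  assumes "Modules.additive A" "Modules.additive B"
    and ev: "\<forall>\<^sub>F x in F. x > 0 \<longrightarrow> A x + p = B x + q"
  shows "A = B" and "p = (q::real)"
proof -
  show "A = B"
  proof
    fix x :: real
    have "\<forall>\<^sub>F s in F. (s > 0 \<longrightarrow> A s + p = B s + q) \<and> (s + x > 0 \<longrightarrow> A (s + x) + p = B (s + x) + q)"
      using affine[OF ev, of 1 x] ev by (simp add: eventually_conj)
    then obtain s where "max 0 (- x) < s"
      "(s > 0 \<longrightarrow> A s + p = B s + q) \<and> (s + x > 0 \<longrightarrow> A (s + x) + p = B (s + x) + q)"
      by (rule meets_above)
    then have "A s + p = B s + q" "A (s + x) + p = B (s + x) + q"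
      by auto
    then show "A x = B x"
      by (simp add: additive.add[OF assms(1)] additive.add[OF assms(2)])
  qed
  moreover obtain x where "0 < x" "x > 0 \<longrightarrow> A x + p = B x + q"
    using ev by (rule meets_above)
  ultimately show "p = q"
    by simp
qed

text \<open>
  For good points \<open>x\<close> and \<open>x'\<close> (those whose vertical line meets the exceptional set in a small
  set) subtraction eliminates \<open>g\<close>: \<open>f x - f x' = h (x + y) - h (x' + y)\<close> for almost all \<open>y\<close>. After a
  shift of \<open>y\<close> the right-hand side is \<open>h (u + e) - h u\<close> with \<open>e = x - x'\<close>, so the left-hand
  side depends on \<open>x - x'\<close> alone. Every real number is such a difference, and the resulting function
  \<open>A\<close> of the difference is additive by telescoping.
  The last conclusion characterizes \<open>A\<close> by \<open>h\<close> alone, which allows it to be compared with the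
  additive function that belongs to \<open>g\<close>.
\<close>

lemma pexider_first:
  fixes f g h :: "real \<Rightarrow> real"
  assumes "\<forall>\<^sub>F x in F. \<forall>\<^sub>F y in F. x > 0 \<longrightarrow> y > 0 \<longrightarrow> f x + g y = h (x + y)"
  obtains A p where "Modules.additive A" "\<forall>\<^sub>F x in F. x > 0 \<longrightarrow> f x = A x + p"
    "\<And>e. \<exists>l. \<forall>\<^sub>F u in F. u > l \<longrightarrow> h (u + e) = h u + A e"
proof -
  define S where "S x \<longleftrightarrow> x > 0 \<and> (\<forall>\<^sub>F y in F. y > 0 \<longrightarrow> f x + g y = h (x + y))" for x
  have S: "\<forall>\<^sub>F x in F. x > 0 \<longrightarrow> S x"
    using assms unfolding S_def by (auto elim!: eventually_mono)
  have shift: "\<forall>\<^sub>F u in F. u > x' \<longrightarrow> u > x - e \<longrightarrow> h (u + e) - h u = f x - f x'"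
    if "S x" "S x'" "e = x - x'" for x x' e
  proof -
    have "\<forall>\<^sub>F y in F. y > 0 \<longrightarrow> f x + g y = h (x + y)" "\<forall>\<^sub>F y in F. y > 0 \<longrightarrow> f x' + g y = h (x' + y)"
      using that unfolding S_def by auto
    then have "\<forall>\<^sub>F y in F. y > 0 \<longrightarrow> f x + g y = h (x + y) \<and> f x' + g y = h (x' + y)"
      by eventually_elim auto
    from affine[OF this, of 1 "- x'"] show ?thesis
      using that by (auto elim!: eventually_mono simp: algebra_simps)
  qed
  have diff: "f x - f x' = f w - f w'" if "S x" "S x'" "S w" "S w'" "x - x' = w - w'" for x x' w w'
  proof -
    define e where "e = x - x'"
    have "\<forall>\<^sub>F u in F. (u > x' \<longrightarrow> u > x - e \<longrightarrow> h (u + e) - h u = f x - f x') \<and>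
        (u > w' \<longrightarrow> u > w - e \<longrightarrow> h (u + e) - h u = f w - f w')"
      using that by (intro eventually_conj shift) (auto simp: e_def)
    then obtain u where "max x' w' < u" "(u > x' \<longrightarrow> u > x - e \<longrightarrow> h (u + e) - h u = f x - f x') \<and>
        (u > w' \<longrightarrow> u > w - e \<longrightarrow> h (u + e) - h u = f w - f w')"
      by (rule meets_above)
    then show ?thesis
      using that by (auto simp: e_def)
  qed
  \<comment> \<open>Taking \<open>x\<close> large makes all three points positive.\<close>
  have ex: "\<exists>x. S x \<and> S (x + e) \<and> S (x + e')" for e e'
  proof -
    have "\<forall>\<^sub>F x in F. (x > 0 \<longrightarrow> S x) \<and> (x + e > 0 \<longrightarrow> S (x + e)) \<and> (x + e' > 0 \<longrightarrow> S (x + e'))"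
      using S affine[OF S, of 1 e] affine[OF S, of 1 e'] by (simp add: eventually_conj)
    then obtain x where "max 0 (max (- e) (- e')) < x"
      "(x > 0 \<longrightarrow> S x) \<and> (x + e > 0 \<longrightarrow> S (x + e)) \<and> (x + e' > 0 \<longrightarrow> S (x + e'))"
      by (rule meets_above)
    then show ?thesis
      by auto
  qed
  have "\<exists>v. \<forall>x x'. S x \<longrightarrow> S x' \<longrightarrow> x - x' = e \<longrightarrow> v = f x - f x'" for e
  proof -
    obtain x where "S x" "S (x + e)"
      using ex by blast
    then show ?thesis
      by (intro exI[of _ "f (x + e) - f x"]) (auto intro!: diff)
  qed
  then obtain A where A: "S x \<Longrightarrow> S x' \<Longrightarrow> A (x - x') = f x - f x'" for x x'
    by metis
  obtain x0 where x0: "S x0"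
    using ex by blast
  have add: "Modules.additive A"
  proof
    fix e e'
    obtain x where "S x" "S (x + e)" "S (x + (e + e'))"
      using ex by blast
    then show "A (e + e') = A e + A e'"
      using A[of "x + (e + e')" x] A[of "x + (e + e')" "x + e"] A[of "x + e" x] by simp
  qed
  show thesis
  proof
    show "Modules.additive A" by (fact add)
    show "\<forall>\<^sub>F x in F. x > 0 \<longrightarrow> f x = A x + (f x0 - A x0)"
      using S
    proof eventually_elim
      case (elim x)
      have "f x = A x + (f x0 - A x0)" if "S x"
        using A[OF that x0] additive.diff[OF add, of x x0] by simp
      with elim show ?case by blast
    qed
    show "\<exists>l. \<forall>\<^sub>F u in F. u > l \<longrightarrow> h (u + e) = h u + A e" for e
    proof -
      obtain x where x: "S x" "S (x + e)"
        using ex by blast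
      then have "\<forall>\<^sub>F u in F. u > x \<longrightarrow> h (u + e) = h u + A e"
        using shift[of "x + e" x e] A[of "x + e" x] by (auto elim!: eventually_mono)
      then show ?thesis ..
    qed
  qed
qed

text \<open>
  The vertical lines give \<open>f\<close>, the horizontal lines give \<open>g\<close>, and the additive parts agree because
  both are the almost everywhere increments of \<open>h\<close>. On almost every line \<open>x + y = s\<close> the value
  \<open>h s\<close> is then read off at a single good point of the segment \<open>0 < x < s\<close>.
\<close>

lemma pexider_generic:
  fixes f g h :: "real \<Rightarrow> real"
  assumes "generic_pair (\<lambda>x y. x > 0 \<longrightarrow> y > 0 \<longrightarrow> f x + g y = h (x + y))"
  shows "\<exists>A p q. Modules.additive A \<and>
    (\<forall>\<^sub>F x in F. x > 0 \<longrightarrow> f x = A x + p \<and> g x = A x + q \<and> h x = A x + (p + q))"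
proof -
  obtain A p where A: "Modules.additive A" and f: "\<forall>\<^sub>F x in F. x > 0 \<longrightarrow> f x = A x + p"
    and hA: "\<And>e. \<exists>l. \<forall>\<^sub>F u in F. u > l \<longrightarrow> h (u + e) = h u + A e"
    using assms pexider_first[of f g h] unfolding generic_pair_def by blast
  have "\<forall>\<^sub>F y in F. \<forall>\<^sub>F x in F. x > 0 \<longrightarrow> y > 0 \<longrightarrow> f x + g y = h (x + y)"
    using assms unfolding generic_pair_def by blast
  then have "\<forall>\<^sub>F y in F. \<forall>\<^sub>F x in F. y > 0 \<longrightarrow> x > 0 \<longrightarrow> g y + f x = h (y + x)"
    by (rule eventually2_mono) (simp add: add.commute)
  then obtain B q where B: "Modules.additive B" and g: "\<forall>\<^sub>F x in F. x > 0 \<longrightarrow> g x = B x + q"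
    and hB: "\<And>e. \<exists>l. \<forall>\<^sub>F u in F. u > l \<longrightarrow> h (u + e) = h u + B e"
    using pexider_first[of g f h] by blast
  have "A = B"
  proof
    fix e
    obtain l l' where "\<forall>\<^sub>F u in F. u > l \<longrightarrow> h (u + e) = h u + A e"
      "\<forall>\<^sub>F u in F. u > l' \<longrightarrow> h (u + e) = h u + B e"
      using hA hB by blast
    then have "\<forall>\<^sub>F u in F. u > max l l' \<longrightarrow> A e = B e"
      by eventually_elim auto
    then obtain u where "max l l' < u" "u > max l l' \<longrightarrow> A e = B e"
      by (rule meets_above)
    then show "A e = B e" by simp
  qed
  have "\<forall>\<^sub>F s in F. \<forall>\<^sub>F t in F. t > 0 \<longrightarrow> s - t > 0 \<longrightarrow> f t + g (s - t) = h s"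
    using assms unfolding generic_pair_def by simp
  then have h: "\<forall>\<^sub>F s in F. s > 0 \<longrightarrow> h s = A s + (p + q)"
  proof eventually_elim
    case (elim s)
    have "\<forall>\<^sub>F t in F. s - t > 0 \<longrightarrow> g (s - t) = A (s - t) + q"
      using affine[OF g, of "-1" s] \<open>A = B\<close> by simp
    with elim f have "\<forall>\<^sub>F t in F. 0 < t \<longrightarrow> t < s \<longrightarrow> h s = A t + p + (A (s - t) + q)"
      by eventually_elim auto
    then show ?case
      using meets[of _ 0 s] by (fastforce simp: additive.diff[OF A])
  qed
  from f g h have "\<forall>\<^sub>F x in F. x > 0 \<longrightarrow> f x = A x + p \<and> g x = A x + q \<and> h x = A x + (p + q)"
    by eventually_elim (use \<open>A = B\<close> in auto)
  with A show ?thesis by blast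
qed

section \<open>The Olkin--Baker equation almost everywhere\<close>

text \<open>
  The factor \<open>z * w\<close> can be applied at once or in two steps. Both ways give an almost everywhere
  formula for \<open>f (z * w * x) - f x\<close> as an additive function plus a constant, and
  \<open>additive_eqI\<close> forces the two formulas to agree.
\<close>

lemma scaling_cocycle:
  fixes f p :: "real \<Rightarrow> real" and H :: "real \<Rightarrow> real \<Rightarrow> real"
  assumes add: "\<And>z. z > 0 \<Longrightarrow> Modules.additive (H z)"
    and ev: "\<And>z. z > 0 \<Longrightarrow> \<forall>\<^sub>F x in F. x > 0 \<longrightarrow> f (z * x) - f x = H z x + p z"
    and z: "z > 0" and w: "w > 0"
  shows "H (z * w) x = H z (w * x) + H w x" and "p (z * w) = p z + p w"
proof -
  have zw: "z * w > 0"
    using z w by simp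
  have "Modules.additive (\<lambda>x. H z (w * x) + H w x)"
    by standard (simp add: distrib_left additive.add[OF add[OF z]] additive.add[OF add[OF w]])
  moreover have "\<forall>\<^sub>F x in F. x > 0 \<longrightarrow> H (z * w) x + p (z * w) = (H z (w * x) + H w x) + (p z + p w)"
  proof -
    have "\<forall>\<^sub>F x in F. w * x > 0 \<longrightarrow> f (z * (w * x)) - f (w * x) = H z (w * x) + p z"
      using affine[OF ev[OF z], of w 0] w by simp
    moreover have "\<forall>\<^sub>F x in F. x > 0 \<longrightarrow> f (z * w * x) - f x = H (z * w) x + p (z * w)"
      using zw by (rule ev)
    ultimately show ?thesis
      using ev[OF w]
    proof eventually_elim
      case (elim x)
      show ?case
      proof
        assume "x > 0"
        with w have "w * x > 0" by simp
        with elim \<open>x > 0\<close> show "H (z * w) x + p (z * w) = H z (w * x) + H w x + (p z + p w)"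
          by (simp add: mult.assoc)
      qed
    qed
  qed
  ultimately have "H (z * w) = (\<lambda>x. H z (w * x) + H w x)" "p (z * w) = p z + p w"
    by (rule additive_eqI[OF add[OF zw]])+
  then show "H (z * w) x = H z (w * x) + H w x" "p (z * w) = p z + p w"
    by simp_all
qed

text \<open>
  Fix a good \<open>x\<close> and replace \<open>y\<close> by \<open>x * y\<close>. Then \<open>x / y\<close> becomes \<open>1 / y\<close>, and the invariance of
  \<open>b\<close> and \<open>c\<close> under the factor \<open>x\<close> turns the equation into
  \<open>a x = c (1 + y) + d (1 / y) - b y\<close> for almost all \<open>y\<close>. The right-hand side does not contain \<open>x\<close>,
  so any two good points have the same value of \<open>a\<close>.
  The invariance does not make \<open>b\<close> or \<open>c\<close> constant by itself, since the exceptional set may vary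
  with the factor; the functional equation is what yields constancy.
\<close>

lemma scale_invariant_first:
  fixes a b c d :: "real \<Rightarrow> real"
  assumes eq: "\<forall>\<^sub>F x in F. \<forall>\<^sub>F y in F. x > 0 \<longrightarrow> y > 0 \<longrightarrow> a x + b y = c (x + y) + d (x / y)"
    and b: "\<And>z. z > 0 \<Longrightarrow> \<forall>\<^sub>F x in F. x > 0 \<longrightarrow> b (z * x) = b x"
    and c: "\<And>z. z > 0 \<Longrightarrow> \<forall>\<^sub>F x in F. x > 0 \<longrightarrow> c (z * x) = c x"
  obtains p where "\<forall>\<^sub>F x in F. x > 0 \<longrightarrow> a x = p"
proof -
  define N where "N x \<longleftrightarrow> (\<forall>\<^sub>F y in F. y > 0 \<longrightarrow> a x = c (1 + y) + d (1 / y) - b y)" for x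
  have N: "\<forall>\<^sub>F x in F. x > 0 \<longrightarrow> N x"
    using eq
  proof eventually_elim
    case (elim x)
    show ?case
    proof
      assume "x > 0"
      have "\<forall>\<^sub>F y in F. y > 0 \<longrightarrow> a x + b (x * y) = c (x * (1 + y)) + d (1 / y)"
        using affine[OF elim, of x 0] \<open>x > 0\<close> by (simp add: zero_less_mult_iff distrib_left)
      moreover have "\<forall>\<^sub>F y in F. 1 + y > 0 \<longrightarrow> c (x * (1 + y)) = c (1 + y)"
        using affine[OF c[OF \<open>x > 0\<close>], of 1 1] by (simp add: add.commute)
      ultimately show "N x"
        unfolding N_def using b[OF \<open>x > 0\<close>] by eventually_elim auto
    qed
  qed
  obtain x0 where "x0 > 0" "x0 > 0 \<longrightarrow> N x0"
    using N by (rule meets_above)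
  then have "N x0" by simp
  have "a x = a x0" if "N x" for x
  proof -
    have "\<forall>\<^sub>F y in F. y > 0 \<longrightarrow> a x = a x0"
      using that \<open>N x0\<close> unfolding N_def by eventually_elim auto
    then show ?thesis
      using meets[of _ 0 1] by fastforce
  qed
  with N have "\<forall>\<^sub>F x in F. x > 0 \<longrightarrow> a x = a x0"
    by (auto elim: eventually_mono)
  then show thesis ..
qed

text \<open>
  Almost everywhere, \<open>a\<close> and \<open>b\<close> are constant by the previous lemma, applied to the vertical and, with
  \<open>d (1 / r)\<close> in place of \<open>d r\<close>, to the horizontal lines. On the line \<open>x + y = s\<close> with the
  parametrization \<open>x = s * u\<close>, the ratio \<open>x / y = u / (1 - u)\<close> does not depend on \<open>s\<close>; hence neither
  does \<open>c s\<close>. For \<open>d\<close> a single good horizontal line suffices: on it \<open>x / y\<close> is an affine function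
  of \<open>x\<close>, so that almost all \<open>x\<close> give almost all ratios. On a vertical line
  \<open>x / y\<close> is an inversion in \<open>y\<close>, under which almost all points need not remain almost all points.
\<close>

lemma scale_invariant_constant:
  fixes a b c d :: "real \<Rightarrow> real"
  assumes eq: "generic_pair (\<lambda>x y. x > 0 \<longrightarrow> y > 0 \<longrightarrow> a x + b y = c (x + y) + d (x / y))"
    and inv: "\<And>z. z > 0 \<Longrightarrow>
      \<forall>\<^sub>F x in F. x > 0 \<longrightarrow> a (z * x) = a x \<and> b (z * x) = b x \<and> c (z * x) = c x"
  obtains p q r where
    "\<forall>\<^sub>F x in F. x > 0 \<longrightarrow> a x = p \<and> b x = q \<and> c x = r \<and> d x = p + q - r"
proof -
  have inv': "\<forall>\<^sub>F x in F. x > 0 \<longrightarrow> a (z * x) = a x" "\<forall>\<^sub>F x in F. x > 0 \<longrightarrow> b (z * x) = b x"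
    "\<forall>\<^sub>F x in F. x > 0 \<longrightarrow> c (z * x) = c x" if "z > 0" for z
    using inv[OF that] by (auto elim: eventually_mono)
  obtain p where p: "\<forall>\<^sub>F x in F. x > 0 \<longrightarrow> a x = p"
    using eq inv' scale_invariant_first[of a b c d] unfolding generic_pair_def by blast
  have eq': "\<forall>\<^sub>F y in F. \<forall>\<^sub>F x in F. x > 0 \<longrightarrow> y > 0 \<longrightarrow> a x + b y = c (x + y) + d (x / y)"
    using eq unfolding generic_pair_def by blast
  then have "\<forall>\<^sub>F y in F. \<forall>\<^sub>F x in F. y > 0 \<longrightarrow> x > 0 \<longrightarrow> b y + a x = c (y + x) + d (1 / (y / x))"
    by (rule eventually2_mono) (simp add: add.commute)
  then obtain q where q: "\<forall>\<^sub>F x in F. x > 0 \<longrightarrow> b x = q"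
    using inv' scale_invariant_first[of b a c "\<lambda>r. d (1 / r)"] by blast
  define N where "N s \<longleftrightarrow> (\<forall>\<^sub>F u in F. 0 < u \<longrightarrow> u < 1 \<longrightarrow> c s = p + q - d (u / (1 - u)))" for s
  have "\<forall>\<^sub>F s in F. \<forall>\<^sub>F t in F. t > 0 \<longrightarrow> s - t > 0 \<longrightarrow> a t + b (s - t) = c s + d (t / (s - t))"
    using eq unfolding generic_pair_def by simp
  then have N: "\<forall>\<^sub>F s in F. s > 0 \<longrightarrow> N s"
  proof eventually_elim
    case (elim s)
    show ?case
    proof
      assume "s > 0"
      have "\<forall>\<^sub>F t in F. s - t > 0 \<longrightarrow> b (s - t) = q"
        using affine[OF q, of "-1" s] by simp
      with elim p have "\<forall>\<^sub>F t in F. 0 < t \<longrightarrow> t < s \<longrightarrow> c s = p + q - d (t / (s - t))"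
        by eventually_elim auto
      from affine[OF this, of s 0] \<open>s > 0\<close>
      have "\<forall>\<^sub>F u in F. 0 < s * u \<longrightarrow> s * u < s \<longrightarrow> c s = p + q - d (s * u / (s - s * u))"
        by simp
      moreover have "s * u / (s - s * u) = u / (1 - u)" for u
        using \<open>s > 0\<close> by (metis mult.right_neutral mult_divide_mult_cancel_left order_less_irrefl right_diff_distrib)
      ultimately show "N s"
        unfolding N_def using \<open>s > 0\<close> by (simp add: zero_less_mult_iff)
    qed
  qed
  obtain s0 where "s0 > 0" "s0 > 0 \<longrightarrow> N s0"
    using N by (rule meets_above)
  then have "N s0" by simp
  have "c s = c s0" if "N s" for s
  proof -
    have "\<forall>\<^sub>F u in F. 0 < u \<longrightarrow> u < 1 \<longrightarrow> c s = c s0"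
      using that \<open>N s0\<close> unfolding N_def by eventually_elim auto
    then show ?thesis
      using meets[of _ 0 1] by fastforce
  qed
  with N have r: "\<forall>\<^sub>F x in F. x > 0 \<longrightarrow> c x = c s0"
    by (auto elim: eventually_mono)
  have "\<forall>\<^sub>F y in F. (\<forall>\<^sub>F x in F. x > 0 \<longrightarrow> y > 0 \<longrightarrow> a x + b y = c (x + y) + d (x / y)) \<and>
      (y > 0 \<longrightarrow> b y = q)"
    using eq' q by (rule eventually_conj)
  then obtain y where y: "y > 0" and
    "(\<forall>\<^sub>F x in F. x > 0 \<longrightarrow> y > 0 \<longrightarrow> a x + b y = c (x + y) + d (x / y)) \<and> (y > 0 \<longrightarrow> b y = q)"
    by (rule meets_above)
  then have eqy: "\<forall>\<^sub>F x in F. x > 0 \<longrightarrow> y > 0 \<longrightarrow> a x + b y = c (x + y) + d (x / y)" and "b y = q"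
    by auto
  have "\<forall>\<^sub>F x in F. x + y > 0 \<longrightarrow> c (x + y) = c s0"
    using affine[OF r, of 1 y] by simp
  with eqy p have "\<forall>\<^sub>F x in F. x > 0 \<longrightarrow> d (x / y) = p + q - c s0"
    by eventually_elim (use y \<open>b y = q\<close> in auto)
  from affine[OF this, of y 0] y have "\<forall>\<^sub>F x in F. x > 0 \<longrightarrow> d x = p + q - c s0"
    by (simp add: zero_less_mult_iff)
  with p q r have "\<forall>\<^sub>F x in F. x > 0 \<longrightarrow> a x = p \<and> b x = q \<and> c x = c s0 \<and> d x = p + q - c s0"
    by eventually_elim auto
  then show thesis ..
qed

text \<open>
  Subtracting the equation at \<open>(x, y)\<close> from the one at \<open>(z * x, z * y)\<close> eliminates \<open>d\<close> and leaves
  a Pexider equation for the increments \<open>a (z * x) - a x\<close> and so on, with additive part \<open>H z\<close> and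
  constants \<open>p z\<close>, \<open>q z\<close>. The cocycle identities make \<open>p\<close> and \<open>q\<close> logarithmic. They also show that
  \<open>H z (w * x) + H w x\<close> is symmetric in \<open>z\<close> and \<open>w\<close>; for \<open>w = 2\<close> additivity turns this into
  \<open>H z x = H 2 (z * x) - H 2 x\<close>. After the subtraction of \<open>H 2\<close>, \<open>p\<close> and \<open>q\<close> the equation persists with
  scale-invariant functions, and these are constant.
\<close>

lemma olkin_baker_generic:
  fixes a b c d :: "real \<Rightarrow> real"
  assumes eq: "generic_pair (\<lambda>x y. x > 0 \<longrightarrow> y > 0 \<longrightarrow> a x + b y = c (x + y) + d (x / y))"
  obtains A La Lb p q r where "Modules.additive A" "logarithmic_type La" "logarithmic_type Lb"
    "\<forall>\<^sub>F x in F. x > 0 \<longrightarrow> a x = A x + La x + p \<and> b x = A x + Lb x + q \<and>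
       c x = A x + La x + Lb x + r \<and> d x = La (x / (x + 1)) - Lb (x + 1) + p + q - r"
proof -
  define R where "R z H p q \<longleftrightarrow> Modules.additive H \<and>
    (\<forall>\<^sub>F x in F. x > 0 \<longrightarrow> a (z * x) - a x = H x + p \<and>
      b (z * x) - b x = H x + q \<and> c (z * x) - c x = H x + (p + q))" for z H p q
  have "\<exists>H p q. R z H p q" if "z > 0" for z
    unfolding R_def
  proof (rule pexider_generic)
    show "generic_pair (\<lambda>x y. x > 0 \<longrightarrow> y > 0 \<longrightarrow>
        (a (z * x) - a x) + (b (z * y) - b y) = c (z * (x + y)) - c (x + y))"
      using generic_pair_conj[OF eq generic_pair_scale[OF eq that]]
      by (rule generic_pair_mono) (use that in \<open>auto simp: distrib_left\<close>)
  qed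
  then obtain H p q where R: "\<And>z. z > 0 \<Longrightarrow> R z (H z) (p z) (q z)"
    by metis
  then have H: "\<And>z. z > 0 \<Longrightarrow> Modules.additive (H z)"
    and ev: "\<And>z. z > 0 \<Longrightarrow> \<forall>\<^sub>F x in F. x > 0 \<longrightarrow> a (z * x) - a x = H z x + p z \<and>
      b (z * x) - b x = H z x + q z \<and> c (z * x) - c x = H z x + (p z + q z)"
    by (simp_all add: R_def)
  have eva: "\<forall>\<^sub>F x in F. x > 0 \<longrightarrow> a (z * x) - a x = H z x + p z"
    and evb: "\<forall>\<^sub>F x in F. x > 0 \<longrightarrow> b (z * x) - b x = H z x + q z" if "z > 0" for z
    using ev[OF that] by (auto elim: eventually_mono)
  have log: "logarithmic_type p" "logarithmic_type q"
    using scaling_cocycle(2)[OF H eva] scaling_cocycle(2)[OF H evb]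
    by (auto simp: logarithmic_type_def)
  define A where "A = H 2"
  have A: "Modules.additive A"
    unfolding A_def by (simp add: H)
  have HA: "H z x = A (z * x) - A x" if "z > 0" for z x
  proof -
    have "H z (2 * x) + H 2 x = H 2 (z * x) + H z x"
      using scaling_cocycle(1)[OF H eva that, of 2 x] scaling_cocycle(1)[OF H eva _ that, of 2 x]
      by (simp add: mult.commute)
    then show ?thesis
      using additive.add[OF H[OF that], of x x] by (simp add: A_def)
  qed
  define a' b' c' d' where "a' x = a x - A x - p x" and "b' x = b x - A x - q x"
    and "c' x = c x - A x - p x - q x" and "d' x = d x - p (x / (x + 1)) + q (x + 1)" for x
  have inv: "\<forall>\<^sub>F x in F. x > 0 \<longrightarrow> a' (z * x) = a' x \<and> b' (z * x) = b' x \<and> c' (z * x) = c' x"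
    if "z > 0" for z
    using ev[OF that]
  proof eventually_elim
    case (elim x)
    have "p (z * x) = p z + p x" "q (z * x) = q z + q x" if "x > 0"
      using log that \<open>z > 0\<close> unfolding logarithmic_type_def by blast+
    with elim show ?case
      unfolding a'_def b'_def c'_def HA[OF that] by (auto simp only: diff_eq_eq)
  qed
  have "generic_pair (\<lambda>x y. x > 0 \<longrightarrow> y > 0 \<longrightarrow> a' x + b' y = c' (x + y) + d' (x / y))"
    using eq
  proof (rule generic_pair_mono, intro impI)
    fix x y :: real
    assume *: "x > 0 \<longrightarrow> y > 0 \<longrightarrow> a x + b y = c (x + y) + d (x / y)" "x > 0" "y > 0"
    have r: "x / y / (x / y + 1) = x / (x + y)" "x / y + 1 = (x + y) / y"
      using * by (simp_all add: field_simps)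
    have L: "L u = L v + L (u / v)" if "logarithmic_type L" "u > 0" "v > 0" for L u v
    proof -
      have "L (v * (u / v)) = L v + L (u / v)"
        using that divide_pos_pos[of u v] unfolding logarithmic_type_def by blast
      then show ?thesis
        using \<open>v > 0\<close> by simp
    qed
    have "p x = p (x + y) + p (x / (x + y))" "q (x + y) = q y + q ((x + y) / y)"
      using * by (simp_all add: L[OF log(1), of x "x + y"] L[OF log(2), of "x + y" y])
    then show "a' x + b' y = c' (x + y) + d' (x / y)"
      using * by (simp add: a'_def b'_def c'_def d'_def r additive.add[OF A])
  qed
  then obtain p' q' r' where
    "\<forall>\<^sub>F x in F. x > 0 \<longrightarrow> a' x = p' \<and> b' x = q' \<and> c' x = r' \<and> d' x = p' + q' - r'"
    using inv by (rule scale_invariant_constant)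
  then have "\<forall>\<^sub>F x in F. x > 0 \<longrightarrow> a x = A x + p x + p' \<and> b x = A x + q x + q' \<and>
      c x = A x + p x + q x + r' \<and> d x = p (x / (x + 1)) - q (x + 1) + p' + q' - r'"
    by eventually_elim (auto simp: a'_def b'_def c'_def d'_def)
  with A log show thesis ..
qed

end

section \<open>Proper linearly invariant ideals as filters\<close>

definition co_ideal :: "real set set \<Rightarrow> real filter" where
  "co_ideal J = Abs_filter (\<lambda>P. {x. \<not> P x} \<in> J)"

context
  fixes J :: "real set set"
  assumes J: "pli_sigma_ideal J"
begin

lemma ideal_subset: "A \<in> J \<Longrightarrow> B \<subseteq> A \<Longrightarrow> B \<in> J"
  using J unfolding pli_sigma_ideal_def by blast

lemma ideal_UN: "(\<And>n::nat. A n \<in> J) \<Longrightarrow> (\<Union>n. A n) \<in> J"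
  using J unfolding pli_sigma_ideal_def by blast

lemma ideal_affine: "A \<in> J \<Longrightarrow> k \<noteq> 0 \<Longrightarrow> (\<lambda>x. k * x + m) ` A \<in> J"
  using J unfolding pli_sigma_ideal_def by blast

lemma ideal_Un:
  assumes "A \<in> J" "B \<in> J"
  shows "A \<union> B \<in> J"
proof (rule ideal_subset)
  show "(\<Union>n::nat. if n = 0 then A else B) \<in> J"
    by (rule ideal_UN) (simp add: assms)
  show "A \<union> B \<subseteq> (\<Union>n::nat. if n = 0 then A else B)"
    by (auto intro: exI[of _ "0::nat"] exI[of _ "1::nat"])
qed

lemma ideal_empty: "{} \<in> J"
proof -
  obtain A where "A \<in> J"
    using J unfolding pli_sigma_ideal_def by blast
  then show ?thesis
    by (rule ideal_subset) simp
qed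

lemma eventually_co_ideal: "eventually P (co_ideal J) \<longleftrightarrow> {x. \<not> P x} \<in> J"
  unfolding co_ideal_def
proof (rule eventually_Abs_filter, rule is_filter.intro)
  show "{x. \<not> True} \<in> J"
    by (simp add: ideal_empty)
  show "{x. \<not> (P x \<and> Q x)} \<in> J" if "{x. \<not> P x} \<in> J" "{x. \<not> Q x} \<in> J" for P Q
    using ideal_Un[OF that] by (rule ideal_subset) auto
  show "{x. \<not> Q x} \<in> J" if "\<forall>x. P x \<longrightarrow> Q x" "{x. \<not> P x} \<in> J" for P Q
    using that(2) by (rule ideal_subset) (use that(1) in auto)
qed

text \<open>
  Countably many dilations of an interval about its midpoint (moved to the origin)
  cover the line, which is not in the ideal.
\<close>

lemma interval_notin_ideal:
  assumes "l < u"
  shows "{l<..<u} \<notin> J"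
proof
  assume "{l<..<u} \<in> J"
  define m where "m = (l + u) / 2"
  have "(\<Union>n::nat. (\<lambda>x. (real n + 1) * x + - ((real n + 1) * m)) ` {l<..<u}) \<in> J"
    by (intro ideal_UN ideal_affine \<open>{l<..<u} \<in> J\<close>) simp
  moreover have "x \<in> (\<Union>n::nat. (\<lambda>x. (real n + 1) * x + - ((real n + 1) * m)) ` {l<..<u})" for x
  proof -
    obtain n :: nat where "\<bar>x\<bar> / ((u - l) / 2) < real n"
      using reals_Archimedean2 by blast
    then have "\<bar>x\<bar> < real n * ((u - l) / 2)"
      using assms by (simp add: field_simps)
    also have "\<dots> \<le> (real n + 1) * ((u - l) / 2)"
      using assms by (intro mult_right_mono) auto
    finally have "\<bar>x / (real n + 1)\<bar> < (u - l) / 2"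
      by (simp add: abs_divide field_simps)
    moreover define y where "y = x / (real n + 1)"
    ultimately have "\<bar>y\<bar> < (u - l) / 2"
      by simp
    then have "m + y \<in> {l<..<u}"
      by (auto simp: m_def abs_less_iff field_simps)
    moreover have "x = (real n + 1) * (m + y) + - ((real n + 1) * m)"
      by (simp add: y_def field_simps)
    ultimately show ?thesis by blast
  qed
  ultimately have "UNIV \<in> J"
    by (auto elim: ideal_subset)
  then show False
    using J unfolding pli_sigma_ideal_def by blast
qed

lemma affine_filter_co_ideal: "affine_filter (co_ideal J)"
proof
  show "\<forall>\<^sub>F x in co_ideal J. P (k * x + m)" if "eventually P (co_ideal J)" "k \<noteq> 0" for P k m
  proof -
    have "(\<lambda>x. (1 / k) * x + - (m / k)) ` {x. \<not> P x} \<in> J"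
      using that by (intro ideal_affine) (auto simp: eventually_co_ideal)
    moreover have "x \<in> (\<lambda>x. (1 / k) * x + - (m / k)) ` {x. \<not> P x}" if "\<not> P (k * x + m)" for x
      using that \<open>k \<noteq> 0\<close> by (intro image_eqI[of _ _ "k * x + m"]) (auto simp: field_simps)
    ultimately show ?thesis
      unfolding eventually_co_ideal by (auto elim: ideal_subset)
  qed
  show "\<exists>x. l < x \<and> x < u \<and> P x" if "eventually P (co_ideal J)" "l < u" for P l u
  proof (rule ccontr)
    assume "\<nexists>x. l < x \<and> x < u \<and> P x"
    then have "{l<..<u} \<subseteq> {x. \<not> P x}" by auto
    with that(1) have "{l<..<u} \<in> J"
      unfolding eventually_co_ideal by (rule ideal_subset)
    then show False
      using interval_notin_ideal[OF that(2)] by blast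
  qed
qed

lemma almost_all_in_iff:
  "almost_all_in J D P \<longleftrightarrow> (\<forall>\<^sub>F x in co_ideal J. x \<in> D \<longrightarrow> P x)"
proof
  assume "almost_all_in J D P"
  then obtain U where "U \<in> J" "\<forall>x \<in> D - U. P x"
    unfolding almost_all_in_def by blast
  then show "\<forall>\<^sub>F x in co_ideal J. x \<in> D \<longrightarrow> P x"
    unfolding eventually_co_ideal by (auto elim: ideal_subset)
next
  assume "\<forall>\<^sub>F x in co_ideal J. x \<in> D \<longrightarrow> P x"
  then show "almost_all_in J D P"
    unfolding almost_all_in_def eventually_co_ideal by (rule bexI[rotated]) auto
qed

lemma Omega_iff:
  "M \<in> Omega J \<longleftrightarrow> (\<forall>\<^sub>F x in co_ideal J. \<forall>\<^sub>F y in co_ideal J. vector [x, y] \<notin> M)"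
  by (simp add: Omega_def almost_all_in_iff plane_section_def eventually_co_ideal)

text \<open>
  A section of \<open>T ` M\<close> is the trace of \<open>M\<close> on a line, seen in a linear parametrization of that line.
  The identity, the transposition \<open>(x, y) \<mapsto> (y, x)\<close> and the map \<open>(x, y) \<mapsto> (x + y, x)\<close>, all of
  determinant \<open>1\<close> or \<open>-1\<close>, give the vertical lines, the horizontal lines and the lines \<open>x + y = s\<close>.
\<close>

lemma generic_pair_compl:
  assumes "M \<in> Omega J" and T: "\<And>T. unimodular T \<Longrightarrow> T ` M \<in> Omega J"
  shows "affine_filter.generic_pair (co_ideal J) (\<lambda>x y. vector [x, y] \<notin> M)"
proof -
  interpret affine_filter "co_ideal J"
    by (rule affine_filter_co_ideal)
  \<comment> \<open>The matrix with rows \<open>(p, q)\<close> and \<open>(r, s)\<close> defines \<open>T\<close>; the function \<open>g\<close> is its inverse.\<close>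
  have image: "(\<forall>\<^sub>F u in co_ideal J. \<forall>\<^sub>F v in co_ideal J.
      vector [fst (g u v), snd (g u v)] \<notin> M)"
    if "\<bar>det (vector [vector [p, q], vector [r, s]] :: real^2^2)\<bar> = 1"
      and g: "\<And>u v. p * fst (g u v) + q * snd (g u v) = u \<and> r * fst (g u v) + s * snd (g u v) = v"
    for p q r s :: real and g
  proof -
    define B :: "real^2^2" where "B = vector [vector [p, q], vector [r, s]]"
    have "unimodular ((*v) B)"
      using that(1) unfolding unimodular_def by (simp add: B_def)
    then have "\<forall>\<^sub>F u in co_ideal J. \<forall>\<^sub>F v in co_ideal J. vector [u, v] \<notin> (*v) B ` M"
      using T by (simp add: Omega_iff)
    moreover have "B *v vector [fst (g u v), snd (g u v)] = vector [u, v]" for u v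
      using g[of u v] by (simp add: B_def vec_eq_iff forall_2 matrix_vector_mult_def sum_2)
    ultimately show ?thesis
      by (auto elim!: eventually_mono) (metis image_eqI)
  qed
  have "\<forall>\<^sub>F y in co_ideal J. \<forall>\<^sub>F x in co_ideal J. vector [x, y] \<notin> M"
    using image[of 0 1 1 0 "\<lambda>u v. (v, u)"] by (simp add: det_2)
  moreover have "\<forall>\<^sub>F s in co_ideal J. \<forall>\<^sub>F t in co_ideal J. vector [t, s - t] \<notin> M"
    using image[of 1 1 1 0 "\<lambda>s t. (t, s - t)"] by (simp add: det_2)
  ultimately show ?thesis
    using assms(1) unfolding generic_pair_def by (simp add: Omega_iff)
qed

end

theorem theorem7:
  fixes J :: "real set set" and M :: "(real^2) set"
    and a b c d :: "real \<Rightarrow> real"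
  assumes "pli_sigma_ideal J"
    and "M \<in> Omega J"
    and "\<And>x y. x > 0 \<Longrightarrow> y > 0 \<Longrightarrow> vector [x, y] \<notin> M \<Longrightarrow>
           a x + b y = c (x + y) + d (x / y)"
    and "\<And>T. unimodular T \<Longrightarrow> T ` M \<in> Omega J"
  shows "\<exists>A La Lb. \<exists>\<alpha> \<beta> \<gamma> :: real.
           additive_on_pos A \<and> logarithmic_type La \<and> logarithmic_type Lb \<and>
           almost_all_in J {0<..} (\<lambda>x.
             a x = A x + La x + \<alpha> \<and>
             b x = A x + Lb x + \<beta> \<and>
             c x = A x + La x + Lb x + \<gamma> \<and>
             d x = La (x / (x + 1)) - Lb (x + 1) + \<alpha> + \<beta> - \<gamma>)"
proof -
  interpret affine_filter "co_ideal J"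
    using assms(1) by (rule affine_filter_co_ideal)
  have "generic_pair (\<lambda>x y. x > 0 \<longrightarrow> y > 0 \<longrightarrow> a x + b y = c (x + y) + d (x / y))"
    using generic_pair_compl[OF assms(1,2,4)] by (rule generic_pair_mono) (auto intro: assms(3))
  then obtain A La Lb p q r where "Modules.additive A" "logarithmic_type La" "logarithmic_type Lb"
    "\<forall>\<^sub>F x in co_ideal J. x > 0 \<longrightarrow> a x = A x + La x + p \<and> b x = A x + Lb x + q \<and>
       c x = A x + La x + Lb x + r \<and> d x = La (x / (x + 1)) - Lb (x + 1) + p + q - r"
    by (rule olkin_baker_generic)
  then show ?thesis
    by (intro exI[of _ A] exI[of _ La] exI[of _ Lb] exI[of _ p] exI[of _ q] exI[of _ r])
      (simp add: almost_all_in_iff[OF assms(1)] additive_on_pos_def additive.add)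
qed

end
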